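(* Let $p\in[1,\infty]$, let $Y$ be a complex Banach space, let $(\mathcal G,+)$ be a countable discrete group and $\mathbf X=\ell^p(\mathcal G,Y)$, with $\mathcal P$ and $\mathcal L(\mathbf X,\mathcal P)$ as in the context. Let $(\Omega,\mathcal G,\alpha)$ be a dynamical system and $A:\Omega\to\mathcal L(\mathbf X,\mathcal P)$ a family of operators over it. Let $\Sigma:=\bigcup_{\omega\in\Omega}\operatorname{spec}(A(\omega))$ and $\lambda\in\mathbb C\setminus\Sigma$. Then $\|(\lambda-A(\omega))^{-1}\|=\|(\lambda-A(\nu))^{-1}\|$ for all pseudoergodic $\omega,\nu\in\Omega$. If $(\Omega,\mathcal G,\alpha)$ is minimal, then $\|(\lambda-A(\omega))^{-1}\|=\|(\lambda-A(\nu))^{-1}\|$ for all $\omega,\nu\in\Omega$.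
   Context: $(\mathcal G,+)$ is written additively but need not be abelian. Choose subsets $\mathcal G_n\subseteq\mathcal G$ with $\emptyset\neq\mathcal G_n\neq\mathcal G$, such that for each $m$ there is $N_m$ with $\mathcal G_m\subseteq\mathcal G_n$ for $n\ge N_m$, and $\bigcup_n\mathcal G_n=\mathcal G$; $P_n$ is multiplication by $\mathbf 1_{\mathcal G_n}$, $\mathcal P=(P_n)$. $K\in\mathcal L(\mathbf X)$ is $\mathcal P$-compact if $\|K(I-P_n)\|\to0$ and $\|(I-P_n)K\|\to0$; $\mathcal K(\mathbf X,\mathcal P)$ is the set of these and $\mathcal L(\mathbf X,\mathcal P)=\{A\in\mathcal L(\mathbf X):AK,KA\in\mathcal K(\mathbf X,\mathcal P)\ \forall K\in\mathcal K(\mathbf X,\mathcal P)\}$. $(A_n)$ converges $\mathcal P$-strongly to $A$ ($\mathcal P\text{-}\lim A_n=A$) if $\|K(A_n-A)\|+\|(A_n-A)K\|\to0$ for all $K\in\mathcal K(\mathbf X,\mathcal P)$. $V_gx=(x_{h+g})_{h\in\mathcal G}$. A dynamical system $(\Omega,\mathcal G,\alpha)$: $\Omega$ compact metric space, $\alpha$ maps $\mathcal G$ to homeomorphisms of $\Omega$ with $\alpha(g+h)=\alpha(g)\circ\alpha(h)$; minimal if every orbit is dense. $g_n\to\infty$ means $(g_n)$ eventually leaves every finite subset of $\mathcal G$; $L(\omega)=\{\nu:\exists g_n\to\infty,\ \alpha(g_n)(\omega)\to\nu\}$; $\omega$ is pseudoergodic if $L(\omega)=\Omega$. A family of operators over $(\Omega,\mathcal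 G,\alpha)$ is $A:\Omega\to\mathcal L(\mathbf X,\mathcal P)$ with $A(\alpha(g)(\omega))=V_gA(\omega)V_{-g}$ for all $\omega,g$, and such that $\omega_n\to\omega$ implies $\mathcal P\text{-}\lim A(\omega_n)=A(\omega)$. *)

theory Defs
  imports "HOL-Analysis.Analysis" "HOL-Library.Countable"
begin

class complex_banach = banach +
  fixes cscale :: "complex \<Rightarrow> 'a \<Rightarrow> 'a" (infixr \<open>*\<^sub>C\<close> 75)
  assumes cscale_of_real: "cscale (complex_of_real r) x = r *\<^sub>R x"
    and cscale_add_left: "cscale (a + b) x = cscale a x + cscale b x"
    and cscale_add_right: "cscale a (x + y) = cscale a x + cscale a y"
    and cscale_assoc: "cscale a (cscale b x) = cscale (a * b) x"
    and cscale_one: "cscale 1 x = x"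
    and norm_cscale: "norm (cscale a x) = cmod a * norm x"

type_synonym ('g, 'y) seq = "'g \<Rightarrow> 'y"

definition lp_space :: "ennreal \<Rightarrow> ('g, 'y::real_normed_vector) seq set" where
  "lp_space p = (if p = \<infinity> then {x. bounded (range x)}
                 else {x. (\<lambda>g. norm (x g) powr enn2real p) summable_on UNIV})"

definition lp_norm :: "ennreal \<Rightarrow> ('g, 'y::real_normed_vector) seq \<Rightarrow> real" where
  "lp_norm p x = (if p = \<infinity> then (SUP g. norm (x g))
                  else (infsum (\<lambda>g. norm (x g) powr enn2real p) UNIV) powr (1 / enn2real p))"

text \<open>Operators are functions on sequences; only their behaviour on the space X
  matters.\<close>

definition bounded_op :: "ennreal \<Rightarrow> (('g, 'y::complex_banach) seq \<Rightarrow> ('g, 'y) seq) \<Rightarrow> bool" where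
  "bounded_op p A \<longleftrightarrow>
     (\<forall>x\<in>lp_space p. A x \<in> lp_space p) \<and>
     (\<forall>x\<in>lp_space p. \<forall>y\<in>lp_space p. A (\<lambda>g. x g + y g) = (\<lambda>g. A x g + A y g)) \<and>
     (\<forall>x\<in>lp_space p. \<forall>c. A (\<lambda>g. c *\<^sub>C x g) = (\<lambda>g. c *\<^sub>C A x g)) \<and>
     (\<exists>C. \<forall>x\<in>lp_space p. lp_norm p (A x) \<le> C * lp_norm p x)"

definition op_norm :: "ennreal \<Rightarrow> (('g, 'y::complex_banach) seq \<Rightarrow> ('g, 'y) seq) \<Rightarrow> real" where
  "op_norm p A = (SUP x\<in>{x\<in>lp_space p. lp_norm p x \<le> 1}. lp_norm p (A x))"

definition op_id :: "('g, 'y) seq \<Rightarrow> ('g, 'y) seq" where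
  "op_id x = x"

definition op_diff :: "(('g, 'y::ab_group_add) seq \<Rightarrow> ('g, 'y) seq) \<Rightarrow> (('g, 'y) seq \<Rightarrow> ('g, 'y) seq)
     \<Rightarrow> ('g, 'y) seq \<Rightarrow> ('g, 'y) seq" where
  "op_diff A B x = (\<lambda>g. A x g - B x g)"

definition op_shift_scalar :: "complex \<Rightarrow> (('g, 'y::complex_banach) seq \<Rightarrow> ('g, 'y) seq)
     \<Rightarrow> ('g, 'y) seq \<Rightarrow> ('g, 'y) seq" where
  "op_shift_scalar z A x = (\<lambda>g. z *\<^sub>C x g - A x g)"

definition is_op_inverse :: "ennreal \<Rightarrow> (('g, 'y::complex_banach) seq \<Rightarrow> ('g, 'y) seq)
     \<Rightarrow> (('g, 'y) seq \<Rightarrow> ('g, 'y) seq) \<Rightarrow> bool" where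
  "is_op_inverse p T S \<longleftrightarrow> bounded_op p S \<and>
     (\<forall>x\<in>lp_space p. S (T x) = x \<and> T (S x) = x)"

definition op_invertible :: "ennreal \<Rightarrow> (('g, 'y::complex_banach) seq \<Rightarrow> ('g, 'y) seq) \<Rightarrow> bool" where
  "op_invertible p T \<longleftrightarrow> bounded_op p T \<and> (\<exists>S. is_op_inverse p T S)"

definition op_inverse :: "ennreal \<Rightarrow> (('g, 'y::complex_banach) seq \<Rightarrow> ('g, 'y) seq)
     \<Rightarrow> ('g, 'y) seq \<Rightarrow> ('g, 'y) seq" where
  "op_inverse p T = (SOME S. is_op_inverse p T S)"

definition spectrum_op :: "ennreal \<Rightarrow> (('g, 'y::complex_banach) seq \<Rightarrow> ('g, 'y) seq) \<Rightarrow> complex set" where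
  "spectrum_op p A = {z. \<not> op_invertible p (op_shift_scalar z A)}"

definition admissible_exhaustion :: "(nat \<Rightarrow> 'g set) \<Rightarrow> bool" where
  "admissible_exhaustion G \<longleftrightarrow>
     (\<forall>n. G n \<noteq> {} \<and> G n \<noteq> UNIV) \<and>
     (\<forall>m. \<exists>N. \<forall>n\<ge>N. G m \<subseteq> G n) \<and>
     (\<Union>n. G n) = UNIV"

definition proj_P :: "'g set \<Rightarrow> ('g, 'y::zero) seq \<Rightarrow> ('g, 'y) seq" where
  "proj_P S x = (\<lambda>h. if h \<in> S then x h else 0)"

definition P_compact :: "ennreal \<Rightarrow> (nat \<Rightarrow> 'g set) \<Rightarrow> (('g, 'y::complex_banach) seq \<Rightarrow> ('g, 'y) seq) \<Rightarrow> bool" where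
  "P_compact p G K \<longleftrightarrow> bounded_op p K \<and>
     (\<lambda>n. op_norm p (K \<circ> op_diff op_id (proj_P (G n)))) \<longlonglongrightarrow> 0 \<and>
     (\<lambda>n. op_norm p (op_diff op_id (proj_P (G n)) \<circ> K)) \<longlonglongrightarrow> 0"

definition L_P :: "ennreal \<Rightarrow> (nat \<Rightarrow> 'g set) \<Rightarrow> (('g, 'y::complex_banach) seq \<Rightarrow> ('g, 'y) seq) \<Rightarrow> bool" where
  "L_P p G A \<longleftrightarrow> bounded_op p A \<and>
     (\<forall>K. P_compact p G K \<longrightarrow> P_compact p G (A \<circ> K) \<and> P_compact p G (K \<circ> A))"

definition P_strong_lim :: "ennreal \<Rightarrow> (nat \<Rightarrow> 'g set) \<Rightarrow> (nat \<Rightarrow> ('g, 'y::complex_banach) seq \<Rightarrow> ('g, 'y) seq)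
     \<Rightarrow> (('g, 'y) seq \<Rightarrow> ('g, 'y) seq) \<Rightarrow> bool" where
  "P_strong_lim p G An A \<longleftrightarrow>
     (\<forall>K. P_compact p G K \<longrightarrow>
        (\<lambda>n. op_norm p (K \<circ> op_diff (An n) A) + op_norm p (op_diff (An n) A \<circ> K)) \<longlonglongrightarrow> 0)"

definition shift_V :: "'g::group_add \<Rightarrow> ('g, 'y) seq \<Rightarrow> ('g, 'y) seq" where
  "shift_V g x = (\<lambda>h. x (h + g))"

definition dynamical_system :: "'w::metric_space set \<Rightarrow> ('g::group_add \<Rightarrow> 'w \<Rightarrow> 'w) \<Rightarrow> bool" where
  "dynamical_system \<Omega> \<alpha> \<longleftrightarrow> compact \<Omega> \<and>
     (\<forall>g. \<exists>h. homeomorphism \<Omega> \<Omega> (\<alpha> g) h) \<and>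
     (\<forall>g h. \<forall>\<omega>\<in>\<Omega>. \<alpha> (g + h) \<omega> = \<alpha> g (\<alpha> h \<omega>))"

definition minimal_system :: "'w::metric_space set \<Rightarrow> ('g \<Rightarrow> 'w \<Rightarrow> 'w) \<Rightarrow> bool" where
  "minimal_system \<Omega> \<alpha> \<longleftrightarrow> (\<forall>\<omega>\<in>\<Omega>. closure (range (\<lambda>g. \<alpha> g \<omega>)) = \<Omega>)"

definition tends_to_infinity :: "(nat \<Rightarrow> 'g) \<Rightarrow> bool" where
  "tends_to_infinity gs \<longleftrightarrow> (\<forall>F. finite F \<longrightarrow> (\<forall>\<^sub>F n in sequentially. gs n \<notin> F))"

definition limit_set :: "('g \<Rightarrow> 'w::metric_space \<Rightarrow> 'w) \<Rightarrow> 'w \<Rightarrow> 'w set" where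
  "limit_set \<alpha> \<omega> = {\<nu>. \<exists>gs. tends_to_infinity gs \<and> (\<lambda>n. \<alpha> (gs n) \<omega>) \<longlonglongrightarrow> \<nu>}"

definition pseudoergodic :: "'w::metric_space set \<Rightarrow> ('g \<Rightarrow> 'w \<Rightarrow> 'w) \<Rightarrow> 'w \<Rightarrow> bool" where
  "pseudoergodic \<Omega> \<alpha> \<omega> \<longleftrightarrow> limit_set \<alpha> \<omega> = \<Omega>"

definition operator_family ::
  "ennreal \<Rightarrow> (nat \<Rightarrow> 'g::group_add set) \<Rightarrow> 'w::metric_space set \<Rightarrow> ('g \<Rightarrow> 'w \<Rightarrow> 'w)
   \<Rightarrow> ('w \<Rightarrow> ('g, 'y::complex_banach) seq \<Rightarrow> ('g, 'y) seq) \<Rightarrow> bool" where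
  "operator_family p G \<Omega> \<alpha> A \<longleftrightarrow>
     (\<forall>\<omega>\<in>\<Omega>. L_P p G (A \<omega>)) \<and>
     (\<forall>\<omega>\<in>\<Omega>. \<forall>g. \<forall>x\<in>lp_space p. A (\<alpha> g \<omega>) x = shift_V g (A \<omega> (shift_V (- g) x))) \<and>
     (\<forall>\<omega>s \<omega>. (\<forall>n. \<omega>s n \<in> \<Omega>) \<longrightarrow> \<omega> \<in> \<Omega> \<longrightarrow> \<omega>s \<longlonglongrightarrow> \<omega> \<longrightarrow>
        P_strong_lim p G (\<lambda>n. A (\<omega>s n)) (A \<omega>))"

end

theory Submission
  imports Defs
begin

text \<open>
  If \<open>\<nu>\<close> is a limit of points \<open>\<alpha> (g\<^sub>n) \<omega>\<close> of the orbit of \<open>\<omega>\<close>, then the resolvent norm at \<open>\<nu>\<close> is at most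
  the resolvent norm \<open>M\<close> at \<open>\<omega>\<close>; equality then holds by symmetry whenever each of two points lies in
  the orbit closure of the other. Put \<open>B \<kappa> = z - A \<kappa>\<close>. The operators \<open>B (\<alpha> (g\<^sub>n) \<omega>)\<close> are isometrically
  conjugate to \<open>B \<omega>\<close>, hence bounded below by \<open>1 / M\<close>, and since multiplication by the indicator of
  \<open>G m\<close> is \<open>P\<close>-compact, this lower bound passes to \<open>B \<nu>\<close> on sequences supported in \<open>G m\<close>. Such
  sequences are dense for \<open>p < \<infinity>\<close>. For \<open>p = \<infinity>\<close> an arbitrary \<open>x\<close> is replaced by \<open>F x\<close>, where \<open>F\<close> is a
  cutoff that equals 1 near a point at which \<open>x\<close> almost attains its norm and whose commutator with
  \<open>A \<nu>\<close> is small in norm.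
\<close>

subsection \<open>The spaces of p-summable sequences\<close>

text \<open>Convexity of the power function on the positive reals settles the case of positive
  \<open>u\<close> and \<open>v\<close>. If one of them is 0, the claim reduces to
  \<open>r powr q \<le> r\<close> for \<open>r\<close> between 0 and 1. This is the scalar
  inequality behind the triangle inequality in \<open>lp_add\<close>.\<close>

lemma powr_convex_combination:
  fixes q s t u v :: real
  assumes q: "1 \<le> q" and st: "0 \<le> s" "0 \<le> t" "s + t = 1" and uv: "0 \<le> u" "0 \<le> v"
  shows "(s * u + t * v) powr q \<le> s * u powr q + t * v powr q"
proof -
  have contract: "(r * w) powr q \<le> r * w powr q" if "0 \<le> r" "r \<le> 1" "0 \<le> w" for r w :: real
  proof -
    have "r powr q \<le> r"
      using that q powr_mono'[of 1 q r] by (cases "r = 0") auto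
    then show ?thesis
      using that by (simp add: powr_mult mult_right_mono)
  qed
  consider "u = 0" | "v = 0" | "0 < u" "0 < v"
    using uv by linarith
  then show ?thesis
  proof cases
    case 1
    then show ?thesis using contract[of t v] st uv q by simp
  next
    case 2
    then show ?thesis using contract[of s u] st uv q by simp
  next
    case 3
    moreover have s: "s = 1 - t" using st by simp
    ultimately show ?thesis
      using convex_onD[OF powr_convex[OF q], of t u v] st unfolding s by simp
  qed
qed

lemma enn2real_ge_one:
  assumes "1 \<le> p" "p \<noteq> (top::ennreal)"
  shows "1 \<le> enn2real p"
  using enn2real_mono[of 1 p] assms by (simp add: top.not_eq_extremum)

lemma lp_space_top: "lp_space top = {x. bounded (range x)}"
  and lp_norm_top: "lp_norm top x = (SUP g. norm (x g))"
  by (simp_all add: lp_space_def lp_norm_def)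

lemma lp_norm_top_le:
  assumes "\<And>g. norm (x g) \<le> c"
  shows "lp_norm top x \<le> c"
  unfolding lp_norm_top using assms by (intro cSUP_least) auto

lemma lp_norm_nonneg:
  assumes "x \<in> lp_space p"
  shows "0 \<le> lp_norm p x"
proof (cases "p = top")
  case True
  then have "bdd_above (range (\<lambda>g. norm (x g)))"
    using assms by (auto simp: lp_space_top bounded_iff bdd_above_def)
  then show ?thesis
    using True cSUP_upper2[of "\<lambda>g. norm (x g)" UNIV undefined 0] by (simp add: lp_norm_top)
qed (simp add: lp_norm_def)

lemma lp_norm_powr:
  assumes "1 \<le> p" "p \<noteq> top"
  shows "lp_norm p x powr enn2real p = infsum (\<lambda>g. norm (x g) powr enn2real p) UNIV"
proof -
  have "0 \<le> infsum (\<lambda>g. norm (x g) powr enn2real p) UNIV"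
    by (rule infsum_nonneg) simp
  then show ?thesis
    using assms enn2real_ge_one[OF assms] by (simp add: lp_norm_def powr_powr)
qed

lemma lp_norm_le_iff:
  assumes "1 \<le> p" "p \<noteq> top" "x \<in> lp_space p" "0 \<le> c"
  shows "lp_norm p x \<le> c \<longleftrightarrow> infsum (\<lambda>g. norm (x g) powr enn2real p) UNIV \<le> c powr enn2real p"
proof -
  have q: "0 < enn2real p" and nn: "0 \<le> lp_norm p x"
    using enn2real_ge_one[OF assms(1,2)] lp_norm_nonneg[OF assms(3)] by auto
  show ?thesis
    unfolding lp_norm_powr[OF assms(1,2), symmetric]
    using powr_mono2[of "enn2real p" "lp_norm p x" c] powr_less_mono2[of "enn2real p" c "lp_norm p x"]
      q nn assms(4) by linarith
qed

lemma norm_le_lp_norm: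
  assumes "1 \<le> p" "x \<in> lp_space p"
  shows "norm (x h) \<le> lp_norm p x"
proof (cases "p = top")
  case True
  then have "bdd_above (range (\<lambda>g. norm (x g)))"
    using assms by (auto simp: lp_space_top bounded_iff bdd_above_def)
  then show ?thesis
    using True by (auto simp: lp_norm_top intro: cSUP_upper)
next
  case False
  let ?q = "enn2real p"
  have "norm (x h) powr ?q \<le> infsum (\<lambda>g. norm (x g) powr ?q) UNIV"
    using finite_sum_le_infsum[of "\<lambda>g. norm (x g) powr ?q" UNIV "{h}"] assms False
    by (simp add: lp_space_def)
  then have "norm (x h) powr ?q \<le> lp_norm p x powr ?q"
    using lp_norm_powr[OF assms(1) False] by metis
  then show ?thesis
    using lp_norm_nonneg[OF assms(2)] enn2real_ge_one[OF assms(1) False]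
      powr_less_mono2[of "enn2real p" "lp_norm p x" "norm (x h)"] by linarith
qed

text \<open>Membership and norm depend on a sequence only through its pointwise norms,
  monotonically. Negations, projections and cutoffs are all handled this way.\<close>

lemma lp_dominated:
  assumes "1 \<le> p" and x: "x \<in> lp_space p" and le: "\<And>g. norm (y g) \<le> norm (x g)"
  shows "y \<in> lp_space p" "lp_norm p y \<le> lp_norm p x"
proof -
  show y: "y \<in> lp_space p"
  proof (cases "p = top")
    case True
    with x obtain c where "\<And>g. norm (x g) \<le> c"
      by (auto simp: lp_space_top bounded_iff)
    with True le show ?thesis
      by (auto simp: lp_space_top bounded_iff intro: order_trans)
  next
    case False
    have "(\<lambda>g. norm (y g) powr enn2real p) summable_on UNIV"
      by (rule summable_on_comparison_test[of "\<lambda>g. norm (x g) powr enn2real p"])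
        (use x False le in \<open>auto simp: lp_space_def intro!: powr_mono2\<close>)
    with False show ?thesis by (simp add: lp_space_def)
  qed
  show "lp_norm p y \<le> lp_norm p x"
  proof (cases "p = top")
    case True
    then show ?thesis
      using norm_le_lp_norm[OF assms(1) x] le by (auto intro: lp_norm_top_le order_trans)
  next
    case False
    then show ?thesis
      unfolding lp_norm_def using x y le
      by (auto simp: lp_space_def intro!: powr_mono2 infsum_mono infsum_nonneg)
  qed
qed

lemma lp_zero:
  assumes "1 \<le> p"
  shows "(\<lambda>_. 0) \<in> lp_space p" "lp_norm p (\<lambda>_. 0) = 0"
  using assms by (auto simp: lp_space_def lp_norm_def)

lemma lp_scale:
  fixes x :: "'g \<Rightarrow> 'y::complex_banach"
  assumes "1 \<le> p" "x \<in> lp_space p"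
  shows "(\<lambda>g. c *\<^sub>C x g) \<in> lp_space p" "lp_norm p (\<lambda>g. c *\<^sub>C x g) = cmod c * lp_norm p x"
proof -
  let ?q = "enn2real p"
  have bdd: "bdd_above (range (\<lambda>g. norm (x g)))" if "p = top"
    using assms that by (auto simp: lp_space_top bounded_iff bdd_above_def)
  show "(\<lambda>g. c *\<^sub>C x g) \<in> lp_space p"
  proof (cases "p = top")
    case True
    with assms(2) obtain b where "\<And>g. norm (x g) \<le> b"
      by (auto simp: lp_space_top bounded_iff)
    then have "norm (c *\<^sub>C x g) \<le> cmod c * b" for g
      by (simp add: norm_cscale mult_left_mono)
    with True show ?thesis
      by (auto simp: lp_space_top bounded_iff)
  next
    case False
    with assms(2) show ?thesis
      by (simp add: lp_space_def norm_cscale powr_mult summable_on_cmult_right)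
  qed
  show "lp_norm p (\<lambda>g. c *\<^sub>C x g) = cmod c * lp_norm p x"
  proof (cases "p = top")
    case True
    have "(SUP g. cmod c * norm (x g)) = cmod c * (SUP g. norm (x g))"
      using continuous_at_Sup_mono[of "\<lambda>t. cmod c * t" "range (\<lambda>g. norm (x g))"] bdd[OF True]
      by (simp add: mono_def mult_left_mono image_image continuous_intros)
    with True show ?thesis
      by (simp add: lp_norm_top norm_cscale)
  next
    case False
    have "0 \<le> infsum (\<lambda>g. norm (x g) powr ?q) UNIV"
      by (rule infsum_nonneg) simp
    then show ?thesis
      using False enn2real_ge_one[OF assms(1) False]
      by (simp add: lp_norm_def norm_cscale powr_mult infsum_cmult_right' powr_powr)
  qed
qed

text \<open>Minkowski's inequality. For finite \<open>p\<close> and norms \<open>a\<close>,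
  \<open>b\<close> both positive, (x + y) / (a + b) is the convex combination of x / a and y / b
  with weights \<open>s\<close> and \<open>t\<close>. Convexity of the q-th power bounds it
  pointwise, and after summation the factors \<open>a powr q\<close> and \<open>b powr q\<close>
  cancel.\<close>

lemma lp_add:
  assumes p: "1 \<le> p" and x: "x \<in> lp_space p" and y: "y \<in> lp_space p"
  shows "(\<lambda>g. x g + y g) \<in> lp_space p"
    and "lp_norm p (\<lambda>g. x g + y g) \<le> lp_norm p x + lp_norm p y"
proof -
  have *: "(\<lambda>g. x g + y g) \<in> lp_space p \<and>
    lp_norm p (\<lambda>g. x g + y g) \<le> lp_norm p x + lp_norm p y"
  proof (cases "p = top")
    case True
    have le: "norm (x g + y g) \<le> lp_norm p x + lp_norm p y" for g
      by (rule order_trans[OF norm_triangle_ineq])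
        (intro add_mono norm_le_lp_norm p x y)
    then show ?thesis
      using True by (auto simp: lp_space_top bounded_iff intro: lp_norm_top_le)
  next
    case False
    define q a b where "q = enn2real p" and "a = lp_norm p x" and "b = lp_norm p y"
    have q: "1 \<le> q"
      using enn2real_ge_one[OF p False] by (simp add: q_def)
    have nn: "0 \<le> a" "0 \<le> b"
      using lp_norm_nonneg x y by (auto simp: a_def b_def)
    \<comment> \<open>A sequence of norm 0 cannot be normalised; it vanishes pointwise by
      \<open>norm_le_lp_norm\<close>.\<close>
    consider "a = 0" | "b = 0" | "0 < a" "0 < b"
      using nn by linarith
    then show ?thesis
    proof cases
      case 1
      then have "x g = 0" for g
        using norm_le_lp_norm[OF p x, of g] by (simp add: a_def)
      then show ?thesis using y 1 by (simp add: a_def)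
    next
      case 2
      then have "y g = 0" for g
        using norm_le_lp_norm[OF p y, of g] by (simp add: b_def)
      then show ?thesis using x 2 by (simp add: b_def)
    next
      case 3
      define s t where "s = a / (a + b)" and "t = b / (a + b)"
      have st: "0 \<le> s" "0 \<le> t" "s + t = 1"
        using 3 by (auto simp: s_def t_def add_divide_distrib[symmetric])
      define f where "f g = (a + b) powr q * s / a powr q * norm (x g) powr q
          + (a + b) powr q * t / b powr q * norm (y g) powr q" for g
      have sx: "(\<lambda>g. norm (x g) powr q) summable_on UNIV" and
        sy: "(\<lambda>g. norm (y g) powr q) summable_on UNIV"
        using x y False by (auto simp: lp_space_def q_def)
      have f_sum: "f summable_on UNIV"
        unfolding f_def by (intro summable_on_add summable_on_cmult_right sx sy)
      have le: "norm (x g + y g) powr q \<le> f g" for g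
      proof -
        have "norm (x g + y g) \<le> (a + b) * (s * (norm (x g) / a) + t * (norm (y g) / b))"
          using 3 norm_triangle_ineq[of "x g" "y g"] by (simp add: s_def t_def divide_simps)
        then have "norm (x g + y g) powr q
            \<le> ((a + b) * (s * (norm (x g) / a) + t * (norm (y g) / b))) powr q"
          using q by (intro powr_mono2) auto
        also have "\<dots> = (a + b) powr q * (s * (norm (x g) / a) + t * (norm (y g) / b)) powr q"
          using 3 st by (simp add: powr_mult)
        also have "\<dots> \<le> (a + b) powr q
            * (s * (norm (x g) / a) powr q + t * (norm (y g) / b) powr q)"
          using 3 q st by (intro mult_left_mono powr_convex_combination) auto
        also have "\<dots> = f g"
          using 3 by (simp add: f_def powr_divide algebra_simps)
        finally show ?thesis .
      qed
      have sxy: "(\<lambda>g. norm (x g + y g) powr q) summable_on UNIV"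
        by (rule summable_on_comparison_test[OF f_sum]) (use le in auto)
      have "infsum (\<lambda>g. norm (x g + y g) powr q) UNIV \<le> infsum f UNIV"
        by (rule infsum_mono[OF sxy f_sum]) (rule le)
      also have "\<dots> = (a + b) powr q * s / a powr q * infsum (\<lambda>g. norm (x g) powr q) UNIV
          + (a + b) powr q * t / b powr q * infsum (\<lambda>g. norm (y g) powr q) UNIV"
        unfolding f_def
        by (subst infsum_add) (intro summable_on_cmult_right sx sy | simp only: infsum_cmult_right')+
      also have "\<dots> = (a + b) powr q * s + (a + b) powr q * t"
        unfolding lp_norm_powr[OF p False, of x, folded a_def q_def, symmetric]
          lp_norm_powr[OF p False, of y, folded b_def q_def, symmetric]
        using 3 by simp
      also have "\<dots> = (a + b) powr q"
        by (simp add: st flip: distrib_left)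
      finally have bound: "infsum (\<lambda>g. norm (x g + y g) powr q) UNIV \<le> (a + b) powr q" .
      have mem: "(\<lambda>g. x g + y g) \<in> lp_space p"
        using sxy False by (simp add: lp_space_def q_def)
      then show ?thesis
        using lp_norm_le_iff[OF p False mem, of "a + b"] bound nn by (simp add: q_def a_def b_def)
    qed
  qed
  then show "(\<lambda>g. x g + y g) \<in> lp_space p"
    and "lp_norm p (\<lambda>g. x g + y g) \<le> lp_norm p x + lp_norm p y"
    by auto
qed

lemma lp_diff:
  assumes p: "1 \<le> p" and x: "x \<in> lp_space p" and y: "y \<in> lp_space p"
  shows "(\<lambda>g. x g - y g) \<in> lp_space p"
    and "lp_norm p (\<lambda>g. x g - y g) \<le> lp_norm p x + lp_norm p y"
proof -
  have y': "(\<lambda>g. - y g) \<in> lp_space p" "lp_norm p (\<lambda>g. - y g) \<le> lp_norm p y"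
    using lp_dominated[OF p y, of "\<lambda>g. - y g"] by auto
  show "(\<lambda>g. x g - y g) \<in> lp_space p"
    and "lp_norm p (\<lambda>g. x g - y g) \<le> lp_norm p x + lp_norm p y"
    using lp_add[OF p x y'(1)] y'(2) by auto
qed

lemma lp_proj:
  assumes "1 \<le> p" "x \<in> lp_space p"
  shows "proj_P S x \<in> lp_space p" "lp_norm p (proj_P S x) \<le> lp_norm p x"
  by (rule lp_dominated[OF assms]; simp add: proj_P_def)+

text \<open>Right translation is a bijection of the group, so the shift merely reindexes the sum or
  the supremum.\<close>

lemma lp_shift:
  fixes x :: "'g::group_add \<Rightarrow> 'y::real_normed_vector"
  shows "shift_V g x \<in> lp_space p \<longleftrightarrow> x \<in> lp_space p" "lp_norm p (shift_V g x) = lp_norm p x"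
proof -
  have bij: "bij_betw (\<lambda>h. h + g) UNIV UNIV"
    by (rule bij_betwI[where g = "\<lambda>h. h - g"]) auto
  have img: "range (\<lambda>h. f (h + g)) = range f" for f :: "'g \<Rightarrow> 'b"
    using bij by (metis bij_betw_def image_image)
  show "shift_V g x \<in> lp_space p \<longleftrightarrow> x \<in> lp_space p"
    using summable_on_reindex_bij_betw[OF bij, of "\<lambda>h. norm (x h) powr enn2real p"] img[of x]
    by (simp add: lp_space_def shift_V_def)
  show "lp_norm p (shift_V g x) = lp_norm p x"
    using infsum_reindex_bij_betw[OF bij, of "\<lambda>h. norm (x h) powr enn2real p"]
      img[of "\<lambda>h. norm (x h)"]
    by (simp add: lp_norm_def shift_V_def)
qed

subsection \<open>Bounded operators and the exhaustion\<close>

lemma cscale_zero_right: "c *\<^sub>C (0::'y::complex_banach) = 0"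
  using norm_cscale[of c "0::'y"] by simp

lemma cscale_diff_right: "c *\<^sub>C (x - y) = c *\<^sub>C x - c *\<^sub>C (y::'y::complex_banach)"
  using cscale_add_right[of c "x - y" y] by (simp add: algebra_simps)

lemma cscale_scaleR: "c *\<^sub>C (r *\<^sub>R x) = r *\<^sub>R (c *\<^sub>C (x::'y::complex_banach))"
  by (simp add: cscale_assoc mult.commute flip: cscale_of_real)

section \<open>Algebra of bounded operators and the operator norm\<close>

lemma bounded_opI:
  assumes "\<And>x. x \<in> lp_space p \<Longrightarrow> A x \<in> lp_space p"
    and "\<And>x y. x \<in> lp_space p \<Longrightarrow> y \<in> lp_space p \<Longrightarrow> A (\<lambda>g. x g + y g) = (\<lambda>g. A x g + A y g)"
    and "\<And>x c. x \<in> lp_space p \<Longrightarrow> A (\<lambda>g. c *\<^sub>C x g) = (\<lambda>g. c *\<^sub>C A x g)"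
    and "\<And>x. x \<in> lp_space p \<Longrightarrow> lp_norm p (A x) \<le> C * lp_norm p x"
  shows "bounded_op p A"
  using assms unfolding bounded_op_def by blast

lemma bounded_op_mem:
  assumes "bounded_op p A" "x \<in> lp_space p"
  shows "A x \<in> lp_space p"
  using assms by (simp add: bounded_op_def)

lemma bounded_op_add:
  assumes "bounded_op p A" "x \<in> lp_space p" "y \<in> lp_space p"
  shows "A (\<lambda>g. x g + y g) = (\<lambda>g. A x g + A y g)"
  using assms by (simp add: bounded_op_def)

lemma bounded_op_cscale:
  assumes "bounded_op p A" "x \<in> lp_space p"
  shows "A (\<lambda>g. c *\<^sub>C x g) = (\<lambda>g. c *\<^sub>C A x g)"
  using assms by (simp add: bounded_op_def)

lemma bounded_op_scaleR:
  assumes "bounded_op p A" "x \<in> lp_space p"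
  shows "A (\<lambda>g. r *\<^sub>R x g) = (\<lambda>g. r *\<^sub>R A x g)"
  using bounded_op_cscale[OF assms, of "complex_of_real r"] by (simp add: cscale_of_real)

lemma bounded_op_diff:
  assumes "bounded_op p A" "1 \<le> p" "x \<in> lp_space p" "y \<in> lp_space p"
  shows "A (\<lambda>g. x g - y g) = (\<lambda>g. A x g - A y g)"
proof -
  have "A (\<lambda>g. (x g - y g) + y g) = (\<lambda>g. A (\<lambda>g. x g - y g) g + A y g)"
    using assms lp_diff by (intro bounded_op_add) auto
  then show ?thesis
    by (auto simp: fun_eq_iff algebra_simps)
qed

lemma bounded_op_sum:
  assumes "bounded_op p A" "1 \<le> p" "finite I" "\<And>i. i \<in> I \<Longrightarrow> x i \<in> lp_space p"
  shows "(\<lambda>g. \<Sum>i\<in>I. x i g) \<in> lp_space p \<and> A (\<lambda>g. \<Sum>i\<in>I. x i g) = (\<lambda>g. \<Sum>i\<in>I. A (x i) g)"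
  using assms(3,4)
proof (induction I rule: finite_induct)
  case empty
  show ?case
    using bounded_op_scaleR[OF assms(1) lp_zero(1)[OF assms(2)], of 0] lp_zero(1)[OF assms(2)]
    by simp
next
  case (insert i I)
  then show ?case
    using bounded_op_add[OF assms(1), of "x i" "\<lambda>g. \<Sum>i\<in>I. x i g"]
      lp_add(1)[OF assms(2), of "x i" "\<lambda>g. \<Sum>i\<in>I. x i g"] by simp
qed

lemma bounded_op_boundE:
  assumes "bounded_op p A"
  obtains C where "0 \<le> C" "\<And>x. x \<in> lp_space p \<Longrightarrow> lp_norm p (A x) \<le> C * lp_norm p x"
proof -
  obtain C where C: "\<And>x. x \<in> lp_space p \<Longrightarrow> lp_norm p (A x) \<le> C * lp_norm p x"
    using assms unfolding bounded_op_def by blast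
  have "lp_norm p (A x) \<le> max C 0 * lp_norm p x" if "x \<in> lp_space p" for x
    using C[OF that] mult_right_mono[of C "max C 0" "lp_norm p x"] lp_norm_nonneg[OF that] by linarith
  then show ?thesis
    using that[of "max C 0"] by simp
qed

lemma bounded_op_op_diff:
  assumes p: "1 \<le> p" and A: "bounded_op p A" and B: "bounded_op p B"
  shows "bounded_op p (op_diff A B)"
proof -
  obtain C D where C: "\<And>x. x \<in> lp_space p \<Longrightarrow> lp_norm p (A x) \<le> C * lp_norm p x"
    and D: "\<And>x. x \<in> lp_space p \<Longrightarrow> lp_norm p (B x) \<le> D * lp_norm p x"
    using bounded_op_boundE[OF A] bounded_op_boundE[OF B] by metis
  have "lp_norm p (op_diff A B x) \<le> (C + D) * lp_norm p x" if "x \<in> lp_space p" for x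
    using lp_diff(2)[OF p bounded_op_mem[OF A that] bounded_op_mem[OF B that]] C[OF that] D[OF that]
    by (simp add: op_diff_def distrib_right)
  moreover have "op_diff A B x \<in> lp_space p" if "x \<in> lp_space p" for x
    using lp_diff(1)[OF p bounded_op_mem[OF A that] bounded_op_mem[OF B that]]
    by (simp add: op_diff_def)
  ultimately show ?thesis
    using A B
    by (intro bounded_opI[where C = "C + D"])
      (auto simp: op_diff_def cscale_diff_right bounded_op_add bounded_op_cscale)
qed

lemma bounded_op_comp:
  assumes A: "bounded_op p A" and B: "bounded_op p B"
  shows "bounded_op p (A \<circ> B)"
proof -
  obtain C D where C: "\<And>x. x \<in> lp_space p \<Longrightarrow> lp_norm p (A x) \<le> C * lp_norm p x" "0 \<le> C"
    and D: "\<And>x. x \<in> lp_space p \<Longrightarrow> lp_norm p (B x) \<le> D * lp_norm p x"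
    using bounded_op_boundE[OF A] bounded_op_boundE[OF B] by metis
  have "lp_norm p (A (B x)) \<le> (C * D) * lp_norm p x" if "x \<in> lp_space p" for x
    using C(1)[OF bounded_op_mem[OF B that]] mult_left_mono[OF D[OF that] C(2)] by simp
  then show ?thesis
    using A B
    by (intro bounded_opI[where C = "C * D"])
      (auto simp: bounded_op_add bounded_op_cscale bounded_op_mem)
qed

lemma bounded_op_id: "bounded_op p op_id"
  by (rule bounded_opI[where C = 1]) (simp_all add: op_id_def)

lemma bounded_op_proj:
  assumes "1 \<le> p"
  shows "bounded_op p (proj_P S)"
  using lp_proj[OF assms]
  by (intro bounded_opI[where C = 1]) (auto simp: proj_P_def fun_eq_iff cscale_zero_right)

lemma bounded_op_shift_scalar:
  assumes "1 \<le> p" "bounded_op p A"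
  shows "bounded_op p (op_shift_scalar z A)"
proof -
  have "bounded_op p (\<lambda>x g. z *\<^sub>C x g)"
    by (rule bounded_opI[where C = "cmod z"])
      (auto simp: lp_scale[OF assms(1)] cscale_add_right cscale_assoc mult.commute)
  from bounded_op_op_diff[OF assms(1) this assms(2)]
  show ?thesis
    by (simp add: op_diff_def[abs_def] op_shift_scalar_def[abs_def])
qed

text \<open>\<open>op_norm\<close> is a real supremum, so it dominates the values on the unit ball
  only once these are known to be bounded above; the constant \<open>C\<close> provides this.
  Rescaling then treats all vectors of nonzero norm, while for norm 0 the bound with
  \<open>C\<close> suffices.\<close>

lemma op_norm_nonneg:
  assumes p: "1 \<le> p" and T: "bounded_op p T"
  shows "0 \<le> op_norm p T"
    and op_norm_bound: "x \<in> lp_space p \<Longrightarrow> lp_norm p (T x) \<le> op_norm p T * lp_norm p x"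
proof -
  let ?U = "{x \<in> lp_space p. lp_norm p x \<le> 1}"
  obtain C where C: "0 \<le> C" "\<And>x. x \<in> lp_space p \<Longrightarrow> lp_norm p (T x) \<le> C * lp_norm p x"
    using bounded_op_boundE[OF T] by metis
  have "lp_norm p (T x) \<le> C" if "x \<in> ?U" for x
    using C(2)[of x] mult_left_mono[of "lp_norm p x" 1 C] C(1) that by simp
  then have bdd: "bdd_above ((\<lambda>x. lp_norm p (T x)) ` ?U)"
    by (auto simp: bdd_above_def)
  have unit: "lp_norm p (T x) \<le> op_norm p T" if "x \<in> ?U" for x
    unfolding op_norm_def by (rule cSUP_upper[OF that bdd])
  have "(\<lambda>_. 0) \<in> ?U"
    by (simp add: lp_zero[OF p])
  then show "0 \<le> op_norm p T"
    using unit lp_norm_nonneg bounded_op_mem[OF T] by (blast intro: order_trans)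
  show "lp_norm p (T x) \<le> op_norm p T * lp_norm p x" if x: "x \<in> lp_space p"
  proof (cases "lp_norm p x = 0")
    case True
    then show ?thesis using C(2)[OF x] by simp
  next
    case False
    then have pos: "0 < lp_norm p x"
      using lp_norm_nonneg[OF x] by simp
    \<comment> \<open>The normalising factor is taken as a complex number because homogeneity in
      \<open>bounded_op\<close> refers to \<open>cscale\<close>.\<close>
    define c where "c = complex_of_real (1 / lp_norm p x)"
    have c: "cmod c = 1 / lp_norm p x"
      using pos by (simp add: c_def norm_divide)
    have "(\<lambda>g. c *\<^sub>C x g) \<in> ?U"
      using lp_scale[OF p x, of c] c pos by simp
    from unit[OF this] have "cmod c * lp_norm p (T x) \<le> op_norm p T"
      using lp_scale(2)[OF p bounded_op_mem[OF T x], of c] bounded_op_cscale[OF T x, of c] by simp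
    then show ?thesis
      using pos by (simp add: c field_simps)
  qed
qed

lemma op_norm_le:
  assumes "1 \<le> p" "0 \<le> M" "\<And>x. x \<in> lp_space p \<Longrightarrow> lp_norm p (T x) \<le> M * lp_norm p x"
  shows "op_norm p T \<le> M"
proof -
  have "lp_norm p (T x) \<le> M" if "x \<in> lp_space p" "lp_norm p x \<le> 1" for x
    using assms(3)[OF that(1)] mult_left_mono[OF that(2) assms(2)] by simp
  then show ?thesis
    unfolding op_norm_def
    by (intro cSUP_least) (auto simp: lp_zero[OF assms(1)] intro!: exI[of _ "\<lambda>_. 0"])
qed

section \<open>Estimates along the exhaustion that follow from operator norm limits\<close>

lemma op_norm_tendsto_zeroD:
  assumes "1 \<le> p" "\<And>n. bounded_op p (T n)" "(\<lambda>n. op_norm p (T n)) \<longlonglongrightarrow> 0" "0 < \<epsilon>"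
  shows "\<forall>\<^sub>F n in sequentially. \<forall>x\<in>lp_space p. lp_norm p (T n x) \<le> \<epsilon> * lp_norm p x"
  using order_tendstoD(2)[OF assms(3,4)]
proof eventually_elim
  case (elim n)
  show ?case
  proof
    fix x :: "'a \<Rightarrow> 'b" assume x: "x \<in> lp_space p"
    show "lp_norm p (T n x) \<le> \<epsilon> * lp_norm p x"
      using op_norm_bound[OF assms(1,2) x, of n]
        mult_right_mono[OF less_imp_le[OF elim] lp_norm_nonneg[OF x]] by linarith
  qed
qed

text \<open>The exhaustion need not be increasing: a point lies in some \<open>G m\<close>, which is
  contained in all later sets from some index on. For finitely many points these indices have a
  common bound.\<close>

lemma admissible_exhaustion_eventually_subset:
  assumes G: "admissible_exhaustion G" and "finite F"
  shows "\<forall>\<^sub>F n in sequentially. F \<subseteq> G n"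
proof -
  have "\<forall>\<^sub>F n in sequentially. g \<in> G n" for g
  proof -
    obtain m where "g \<in> G m"
      using G unfolding admissible_exhaustion_def by blast
    then show ?thesis
      using G unfolding admissible_exhaustion_def eventually_sequentially by blast
  qed
  then have "\<forall>\<^sub>F n in sequentially. \<forall>g\<in>F. g \<in> G n"
    using assms(2) by (simp add: eventually_ball_finite)
  then show ?thesis
    by (simp add: subset_eq)
qed

text \<open>Both products with I - P_n are exactly zero as soon as
  \<open>G m \<subseteq> G n\<close>.\<close>

lemma P_compact_proj:
  fixes G :: "nat \<Rightarrow> 'g set"
  assumes p: "1 \<le> p" and G: "admissible_exhaustion G"
  shows "P_compact p G (proj_P (G m) :: ('g, 'y::complex_banach) seq \<Rightarrow> _)"
proof -
  let ?P = "proj_P (G m) :: ('g, 'y) seq \<Rightarrow> _"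
  have ev: "\<forall>\<^sub>F n in sequentially. G m \<subseteq> G n"
    using G by (auto simp: admissible_exhaustion_def eventually_sequentially)
  have "bounded_op p ((\<lambda>_ _. 0) :: ('g, 'y) seq \<Rightarrow> _)"
    by (rule bounded_opI[where C = 0]) (simp_all add: lp_zero[OF p] cscale_zero_right)
  then have zero: "op_norm p ((\<lambda>_ _. 0) :: ('g, 'y) seq \<Rightarrow> ('g, 'y) seq) = 0"
    by (intro antisym op_norm_le op_norm_nonneg p) (simp_all add: lp_zero[OF p])
  have "?P \<circ> op_diff op_id (proj_P (G n)) = (\<lambda>_ _. 0)"
    "op_diff op_id (proj_P (G n)) \<circ> ?P = (\<lambda>_ _. 0)" if "G m \<subseteq> G n" for n
    using that by (auto simp: fun_eq_iff op_diff_def op_id_def proj_P_def)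
  then have "\<forall>\<^sub>F n in sequentially. op_norm p (?P \<circ> op_diff op_id (proj_P (G n))) = 0"
    "\<forall>\<^sub>F n in sequentially. op_norm p (op_diff op_id (proj_P (G n)) \<circ> ?P) = 0"
    using ev zero by (auto elim!: eventually_mono)
  then show ?thesis
    unfolding P_compact_def using bounded_op_proj[OF p] by (auto intro: tendsto_eventually)
qed

text \<open>By \<open>P_compact_proj\<close>, membership in \<open>L_P\<close> makes P_m A and A P_m
  P-compact. Their defining limits say that P_m A (I - P_n) and (I - P_n) A P_m tend to 0 in norm:
  \<open>A\<close> transports little between \<open>G m\<close> and the complement of
  \<open>G n\<close>, in either direction.\<close>

lemma L_P_eventually_small:
  assumes p: "1 \<le> p" and G: "admissible_exhaustion G" and A: "L_P p G A" and "0 < \<epsilon>"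
  shows "\<forall>\<^sub>F n in sequentially. \<forall>x\<in>lp_space p.
      lp_norm p (proj_P (G m) (A (op_diff op_id (proj_P (G n)) x))) \<le> \<epsilon> * lp_norm p x \<and>
      lp_norm p (op_diff op_id (proj_P (G n)) (A (proj_P (G m) x))) \<le> \<epsilon> * lp_norm p x"
proof -
  have "P_compact p G (A \<circ> proj_P (G m))" "P_compact p G (proj_P (G m) \<circ> A)"
    using A P_compact_proj[OF p G] by (auto simp: L_P_def)
  then have lim: "(\<lambda>n. op_norm p (proj_P (G m) \<circ> A \<circ> op_diff op_id (proj_P (G n)))) \<longlonglongrightarrow> 0"
    "(\<lambda>n. op_norm p (op_diff op_id (proj_P (G n)) \<circ> (A \<circ> proj_P (G m)))) \<longlonglongrightarrow> 0"
    by (auto simp: P_compact_def)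
  have bd: "bounded_op p (proj_P (G m) \<circ> A \<circ> op_diff op_id (proj_P (G n)))"
    "bounded_op p (op_diff op_id (proj_P (G n)) \<circ> (A \<circ> proj_P (G m)))" for n
    using A by (auto simp: L_P_def intro!: bounded_op_comp bounded_op_proj p bounded_op_op_diff bounded_op_id)
  show ?thesis
    using op_norm_tendsto_zeroD[OF p bd(1) lim(1) \<open>0 < \<epsilon>\<close>]
      op_norm_tendsto_zeroD[OF p bd(2) lim(2) \<open>0 < \<epsilon>\<close>]
    by eventually_elim simp
qed

subsection \<open>Lower bounds and resolvent norms\<close>

text \<open>Iterating a choice function \<open>f\<close> from \<open>m\<close> extracts nested sets
  out of an exhaustion that is only eventually increasing. The relation \<open>Q\<close> carries the
  estimate wanted between consecutive sets.\<close>

lemma nested_exhaustion: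
  assumes G: "admissible_exhaustion G"
    and ev: "\<And>m. \<forall>\<^sub>F n in sequentially. Q m n"
  obtains s :: "nat \<Rightarrow> nat" where "s 0 = m" "\<And>k. G (s k) \<subseteq> G (s (Suc k))" "\<And>k. Q (s k) (s (Suc k))"
proof -
  have "\<exists>n. G i \<subseteq> G n \<and> Q i n" for i
  proof -
    have "\<forall>\<^sub>F n in sequentially. G i \<subseteq> G n"
      using G by (auto simp: admissible_exhaustion_def eventually_sequentially)
    then have "\<forall>\<^sub>F n in sequentially. G i \<subseteq> G n \<and> Q i n"
      using ev[of i] by eventually_elim simp
    then show ?thesis
      by (auto simp: eventually_sequentially)
  qed
  then obtain f where f: "\<And>i. G i \<subseteq> G (f i)" "\<And>i. Q i (f i)"
    by metis
  show ?thesis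
    by (rule that[of "\<lambda>k. (f ^^ k) m"]) (auto simp: f intro: subsetD[OF f(1)])
qed

text \<open>The cutoff \<open>F\<close> is the average of the indicators of \<open>N\<close> nested sets of the exhaustion, chosen
  such that \<open>A\<close> is almost block tridiagonal with respect to them. At each point at most two of the
  \<open>N\<close> commutators with these indicators fail to be small.\<close>

lemma almost_commuting_cutoff:
  fixes G :: "nat \<Rightarrow> 'g set" and A :: "('g, 'y::complex_banach) seq \<Rightarrow> ('g, 'y) seq"
  assumes G: "admissible_exhaustion G" and A: "L_P top G A" and \<epsilon>: "0 < \<epsilon>"
  obtains F :: "'g \<Rightarrow> real" and n where
    "\<And>h. 0 \<le> F h" "\<And>h. F h \<le> 1" "\<And>h. h \<in> G m \<Longrightarrow> F h = 1" "\<And>h. h \<notin> G n \<Longrightarrow> F h = 0"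
    "\<And>x h. x \<in> lp_space top \<Longrightarrow>
      norm (F h *\<^sub>R A x h - A (\<lambda>g. F g *\<^sub>R x g) h) \<le> \<epsilon> * lp_norm top x"
proof -
  have p: "(1::ennreal) \<le> top" by simp
  have bA: "bounded_op top A" using A by (simp add: L_P_def)
  obtain C where C: "0 \<le> C" "\<And>x. x \<in> lp_space top \<Longrightarrow> lp_norm top (A x) \<le> C * lp_norm top x"
    using bounded_op_boundE[OF bA] by metis
  \<comment> \<open>Half of \<open>\<epsilon>\<close> pays for the commutators that are small; the
    other half is left for the exceptional ones.\<close>
  define \<delta> where "\<delta> = \<epsilon> / 2"
  have \<delta>: "0 < \<delta>" using \<epsilon> by (simp add: \<delta>_def)
  obtain s where s0: "s 0 = m" and sub: "\<And>k. G (s k) \<subseteq> G (s (Suc k))"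
    and small: "\<And>k. \<forall>x\<in>lp_space top.
      lp_norm top (proj_P (G (s k)) (A (op_diff op_id (proj_P (G (s (Suc k)))) x))) \<le> \<delta> * lp_norm top x \<and>
      lp_norm top (op_diff op_id (proj_P (G (s (Suc k)))) (A (proj_P (G (s k)) x))) \<le> \<delta> * lp_norm top x"
    by (rule nested_exhaustion[OF G L_P_eventually_small[OF p G A \<delta>], of m]) (rule that)
  define S where "S k = G (s k)" for k
  have mono: "S i \<subseteq> S j" if "i \<le> j" for i j
    unfolding S_def using sub that by (rule lift_Suc_mono_le)
  \<comment> \<open>At most two exceptional terms of size \<open>C * lp_norm top x\<close> occur in
    an average over \<open>N\<close>, so \<open>N\<close> is chosen to make
    \<open>2 * C / N \<le> \<epsilon> / 2\<close>.\<close>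
  obtain N :: nat where N: "4 * C / \<epsilon> < N" "0 < N"
  proof -
    obtain N :: nat where "max 0 (4 * C / \<epsilon>) < N"
      using reals_Archimedean2 by blast
    then show ?thesis using that[of N] by simp
  qed
  \<comment> \<open>The average starts at \<open>S 1\<close>, so that each set
    \<open>S (Suc k)\<close> in it has an inner neighbour \<open>S k\<close> and an outer neighbour
    \<open>S (Suc (Suc k))\<close>. All of them contain \<open>S 0\<close>, which is
    \<open>G m\<close>.\<close>
  define F where "F h = (\<Sum>k<N. indicator (S (Suc k)) h) / real N" for h
  have F0: "0 \<le> F h" for h
    by (simp add: F_def sum_nonneg)
  have "(\<Sum>k<N. indicator (S (Suc k)) h) \<le> (\<Sum>k<N. 1::real)" for h
    by (intro sum_mono) (simp add: indicator_def)
  then have F1: "F h \<le> 1" for h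
    using N by (simp add: F_def)
  have Fm: "F h = 1" if "h \<in> G m" for h
  proof -
    have "h \<in> S (Suc k)" for k
      using mono[of 0 "Suc k"] that s0 by (auto simp: S_def)
    then show ?thesis using N by (simp add: F_def)
  qed
  have Fn: "F h = 0" if "h \<notin> G (s N)" for h
  proof -
    have "h \<notin> S (Suc k)" if "k < N" for k
      using mono[of "Suc k" N] that \<open>h \<notin> G (s N)\<close> by (auto simp: S_def)
    then show ?thesis by (simp add: F_def)
  qed
  have comm: "norm (F h *\<^sub>R A x h - A (\<lambda>g. F g *\<^sub>R x g) h) \<le> \<epsilon> * lp_norm top x"
    if x: "x \<in> lp_space top" for x h
  proof -
    define P where "P k = proj_P (S k) x" for k
    have P: "P k \<in> lp_space top" "lp_norm top (P k) \<le> lp_norm top x" for k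
      using lp_proj[OF p x] by (auto simp: P_def)
    \<comment> \<open>The commutator of \<open>A\<close> with the indicator of
      \<open>S (Suc k)\<close>, applied to \<open>x\<close> and evaluated at
      \<open>h\<close>.\<close>
    define D where "D k = indicator (S (Suc k)) h *\<^sub>R A x h - A (P (Suc k)) h" for k
    have nx: "0 \<le> lp_norm top x" by (rule lp_norm_nonneg[OF x])
    \<comment> \<open>The difference of indicators is 1 exactly on the layer between
      \<open>S k\<close> and \<open>S (Suc (Suc k))\<close>, where only the crude bound by
      \<open>C\<close> is claimed.\<close>
    have D: "norm (D k) \<le> \<delta> * lp_norm top x
        + C * lp_norm top x * (indicator (S (Suc (Suc k))) h - indicator (S k) h)" for k
    proof -
      let ?Q = "\<lambda>g. x g - P (Suc k) g"
      have Q: "op_diff op_id (proj_P (G (s (Suc k)))) x = ?Q"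
        by (simp add: op_diff_def op_id_def P_def S_def)
      have Q': "?Q \<in> lp_space top" "lp_norm top ?Q \<le> lp_norm top x"
        by (rule lp_dominated[OF p x]; simp add: P_def proj_P_def)+
      have AQ: "A ?Q h = A x h - A (P (Suc k)) h"
        using bounded_op_diff[OF bA p x P(1)] by simp
      have bQ: "norm (A ?Q h) \<le> C * lp_norm top x"
        using norm_le_lp_norm[OF p bounded_op_mem[OF bA Q'(1)], of h] C(2)[OF Q'(1)]
          mult_left_mono[OF Q'(2) C(1)] by linarith
      have bP: "norm (A (P (Suc k)) h) \<le> C * lp_norm top x"
        using norm_le_lp_norm[OF p bounded_op_mem[OF bA P(1)], of "Suc k" h] C(2)[OF P(1)]
          mult_left_mono[OF P(2) C(1)] by (meson order_trans)
      \<comment> \<open>Inside \<open>S k\<close>, \<open>D k\<close> is the value of A (I - P) x,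
        and outside \<open>S (Suc (Suc k))\<close> it is that of - A P x, with P the projection to
        \<open>S (Suc k)\<close>. Each is small by one of the two estimates in \<open>small\<close>.
        The two middle cases form the layer.\<close>
      consider "h \<in> S k" | "h \<in> S (Suc k)" "h \<notin> S k" | "h \<in> S (Suc (Suc k))" "h \<notin> S (Suc k)"
        | "h \<notin> S (Suc (Suc k))" by blast
      then show ?thesis
      proof cases
        case 1
        then have h: "h \<in> S (Suc k)" "h \<in> S (Suc (Suc k))"
          using mono[of k "Suc k"] mono[of k "Suc (Suc k)"] by auto
        have mem: "proj_P (G (s k)) (A ?Q) \<in> lp_space top"
          using lp_proj(1)[OF p bounded_op_mem[OF bA Q'(1)]] .
        have "norm (A ?Q h) = norm (proj_P (G (s k)) (A ?Q) h)"
          using 1 by (simp add: proj_P_def S_def)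
        also have "\<dots> \<le> \<delta> * lp_norm top x"
          using norm_le_lp_norm[OF p mem, of h] small[of k] x by (auto simp: Q)
        finally show ?thesis
          using 1 h AQ by (simp add: D_def)
      next
        case 2
        then have "h \<in> S (Suc (Suc k))"
          using mono[of "Suc k" "Suc (Suc k)"] by auto
        with 2 bQ AQ nx \<delta> show ?thesis by (simp add: D_def add_increasing)
      next
        case 3
        then have "h \<notin> S k"
          using mono[of k "Suc k"] by auto
        with 3 bP nx \<delta> show ?thesis by (simp add: D_def add_increasing)
      next
        case 4
        then have h: "h \<notin> S (Suc k)" "h \<notin> S k"
          using mono[of "Suc k" "Suc (Suc k)"] mono[of k "Suc (Suc k)"] by auto
        let ?y = "op_diff op_id (proj_P (G (s (Suc (Suc k))))) (A (P (Suc k)))"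
        have mem: "?y \<in> lp_space top"
          by (rule bounded_op_mem[OF bounded_op_op_diff[OF p bounded_op_id bounded_op_proj[OF p]]
                bounded_op_mem[OF bA P(1)]])
        have "norm (A (P (Suc k)) h) = norm (?y h)"
          using 4 by (simp add: proj_P_def S_def op_diff_def op_id_def)
        also have "\<dots> \<le> \<delta> * lp_norm top x"
          using norm_le_lp_norm[OF p mem, of h] small[of "Suc k"] x by (auto simp: P_def S_def)
        finally show ?thesis
          using 4 h by (simp add: D_def)
      qed
    qed
    \<comment> \<open>Telescoping with step two leaves four boundary terms, of which only two are
      positive. This is the count of at most two layers containing \<open>h\<close>.\<close>
    have tele: "(\<Sum>k<n. indicator (S (Suc (Suc k))) h - indicator (S k) h)
        = indicator (S (Suc n)) h + indicator (S n) h - indicator (S 1) h - (indicator (S 0) h :: real)" for n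
      by (induction n) auto
    have "(\<Sum>k<N. indicator (S (Suc (Suc k))) h - indicator (S k) h) \<le> (2::real)"
      unfolding tele by (simp add: indicator_def)
    then have tele2: "C * lp_norm top x * (\<Sum>k<N. indicator (S (Suc (Suc k))) h - indicator (S k) h)
        \<le> C * lp_norm top x * 2"
      using C nx by (intro mult_left_mono) auto
    have Fx: "(\<lambda>g. F g *\<^sub>R x g) = (\<lambda>g. (1 / real N) *\<^sub>R (\<Sum>k<N. P (Suc k) g))"
    proof
      fix g
      have "P k g = indicator (S k) g *\<^sub>R x g" for k
        by (simp add: P_def proj_P_def)
      then show "F g *\<^sub>R x g = (1 / real N) *\<^sub>R (\<Sum>k<N. P (Suc k) g)"
        by (simp add: F_def scaleR_sum_left[symmetric])
    qed
    have AFx: "A (\<lambda>g. F g *\<^sub>R x g) h = (1 / real N) *\<^sub>R (\<Sum>k<N. A (P (Suc k)) h)"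
      unfolding Fx using bounded_op_sum[OF bA p, of "{..<N}" "\<lambda>k. P (Suc k)"] P(1)
        bounded_op_scaleR[OF bA, of "\<lambda>g. \<Sum>k<N. P (Suc k) g" "1 / real N"] by simp
    have "F h *\<^sub>R A x h - A (\<lambda>g. F g *\<^sub>R x g) h = (1 / real N) *\<^sub>R (\<Sum>k<N. D k)"
      unfolding AFx by (simp add: D_def F_def sum_subtractf scaleR_diff_right scaleR_sum_left[symmetric])
    then have "norm (F h *\<^sub>R A x h - A (\<lambda>g. F g *\<^sub>R x g) h) = norm (\<Sum>k<N. D k) / N"
      by simp
    also have "\<dots> \<le> (\<Sum>k<N. norm (D k)) / N"
      by (intro divide_right_mono norm_sum) simp
    also have "\<dots> \<le> (\<Sum>k<N. \<delta> * lp_norm top x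
        + C * lp_norm top x * (indicator (S (Suc (Suc k))) h - indicator (S k) h)) / N"
      by (intro divide_right_mono sum_mono D) simp
    also have "\<dots> \<le> (N * \<delta> * lp_norm top x + C * lp_norm top x * 2) / N"
      using tele2 by (intro divide_right_mono) (simp_all add: sum.distrib sum_distrib_left)
    also have "\<dots> = (\<delta> + 2 * C / N) * lp_norm top x"
      using N by (simp add: field_simps)
    also have "\<dots> \<le> \<epsilon> * lp_norm top x"
    proof (rule mult_right_mono[OF _ nx])
      have "2 * C / N \<le> \<epsilon> / 2"
        using N \<epsilon> by (simp add: field_simps)
      then show "\<delta> + 2 * C / N \<le> \<epsilon>"
        by (simp add: \<delta>_def)
    qed
    finally show ?thesis .
  qed
  show ?thesis
    by (rule that[of F "s N"]) (use F0 F1 Fm Fn comm in auto)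
qed

section \<open>From truncated sequences to all sequences\<close>

lemma lp_proj_approximation:
  assumes p: "1 \<le> p" "p \<noteq> top" and G: "admissible_exhaustion G" and x: "x \<in> lp_space p" and \<delta>: "0 < \<delta>"
  obtains m where "lp_norm p (\<lambda>g. x g - proj_P (G m) x g) \<le> \<delta>"
proof -
  let ?f = "\<lambda>g. norm (x g) powr enn2real p"
  have f: "?f summable_on UNIV"
    using x p by (simp add: lp_space_def)
  \<comment> \<open>A finite set \<open>F\<close> carries the whole sum up to
    \<open>\<delta> powr enn2real p\<close>. Once \<open>G m\<close> contains \<open>F\<close>, the
    truncation error is dominated by the tail over \<open>- F\<close>.\<close>
  obtain F where F: "finite F" "dist (sum ?f F) (infsum ?f UNIV) \<le> \<delta> powr enn2real p"
    using infsum_finite_approximation[OF f, of "\<delta> powr enn2real p"] \<delta> by auto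
  obtain m where m: "F \<subseteq> G m"
    using admissible_exhaustion_eventually_subset[OF G F(1)] by (auto simp: eventually_sequentially)
  let ?y = "\<lambda>g. x g - proj_P (G m) x g"
  have y: "?y \<in> lp_space p"
    using lp_diff(1)[OF p(1) x lp_proj(1)[OF p(1) x]] .
  have f': "?f summable_on -F"
    using f by (rule summable_on_subset_banach) simp
  have "infsum (\<lambda>g. norm (?y g) powr enn2real p) UNIV \<le> infsum ?f (- F)"
    by (rule infsum_mono_neutral) (use y p m f' in \<open>auto simp: lp_space_def proj_P_def\<close>)
  also have "\<dots> = infsum ?f UNIV - sum ?f F"
    using infsum_Un_disjoint[of ?f F "- F"] f' F(1) by simp
  also have "\<dots> \<le> \<delta> powr enn2real p"
    using F(2) by (simp add: dist_real_def)
  finally show ?thesis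
    using that[of m] lp_norm_le_iff[OF p y] \<delta> by simp
qed

text \<open>For finite \<open>p\<close>, density of truncated sequences and boundedness of the
  operator suffice. For \<open>p = top\<close> the estimate is proved at each point \<open>h\<close>
  with a cutoff equal to 1 there: multiplication by \<open>F\<close> commutes with \<open>z\<close>,
  so \<open>op_shift_scalar z A\<close> applied to \<open>F x\<close> differs from \<open>F\<close>
  times its value at \<open>x\<close> only by the commutator with \<open>A\<close>.\<close>

lemma lower_bound_extends:
  assumes p: "1 \<le> p" and G: "admissible_exhaustion G" and A: "L_P p G A" and M: "0 \<le> M"
    and lower: "\<And>m x. x \<in> lp_space p \<Longrightarrow>
      lp_norm p (proj_P (G m) x) \<le> M * lp_norm p (op_shift_scalar z A (proj_P (G m) x))"
    and x: "x \<in> lp_space p"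
  shows "lp_norm p x \<le> M * lp_norm p (op_shift_scalar z A x)"
proof -
  let ?B = "op_shift_scalar z A"
  have bA: "bounded_op p A" using A by (simp add: L_P_def)
  have bB: "bounded_op p ?B" by (rule bounded_op_shift_scalar[OF p bA])
  show ?thesis
  proof (cases "p = top")
    case True
    have nx: "0 \<le> lp_norm p x" by (rule lp_norm_nonneg[OF x])
    have "norm (x h) \<le> M * lp_norm p (?B x) + e" if "0 < e" for h e
    proof -
      \<comment> \<open>Makes the error \<open>M * \<epsilon> * lp_norm p x\<close> at most
        \<open>e\<close>; the added 1 keeps the denominator positive.\<close>
      define \<epsilon> where "\<epsilon> = e / (M * lp_norm p x + 1)"
      have pos: "0 < M * lp_norm p x + 1"
        using M nx by (simp add: add_nonneg_pos)
      then have \<epsilon>: "0 < \<epsilon>" using that by (simp add: \<epsilon>_def)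
      obtain m where m: "h \<in> G m"
        using G unfolding admissible_exhaustion_def by blast
      obtain F n where F: "\<And>h. 0 \<le> F h" "\<And>h. F h \<le> 1" "\<And>h. h \<in> G m \<Longrightarrow> F h = 1"
        "\<And>h. h \<notin> G n \<Longrightarrow> F h = 0"
        "\<And>x h. x \<in> lp_space top \<Longrightarrow>
          norm (F h *\<^sub>R A x h - A (\<lambda>g. F g *\<^sub>R x g) h) \<le> \<epsilon> * lp_norm top x"
        by (rule almost_commuting_cutoff[OF G A[unfolded True] \<epsilon>, of m]) (rule that)
      let ?y = "\<lambda>g. F g *\<^sub>R x g"
      have y: "?y \<in> lp_space p"
        by (rule lp_dominated[OF p x]) (use F(1,2) in \<open>simp add: mult_left_le_one_le\<close>)
      \<comment> \<open>\<open>lower\<close> is applied with the index \<open>n\<close> of the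
        support of \<open>F\<close>, not with the index \<open>m\<close> of the set where
        \<open>F\<close> is 1.\<close>
      have Py: "proj_P (G n) ?y = ?y"
        using F(4) by (auto simp: proj_P_def)
      have "norm (?B ?y k) \<le> lp_norm p (?B x) + \<epsilon> * lp_norm p x" for k
      proof -
        have eq: "?B ?y k = F k *\<^sub>R ?B x k + (F k *\<^sub>R A x k - A ?y k)"
          by (simp add: op_shift_scalar_def cscale_scaleR scaleR_diff_right)
        have "norm (?B ?y k) \<le> norm (F k *\<^sub>R ?B x k) + norm (F k *\<^sub>R A x k - A ?y k)"
          unfolding eq by (rule norm_triangle_ineq)
        moreover have "norm (F k *\<^sub>R ?B x k) \<le> norm (?B x k)"
          using F(1,2) by (simp add: mult_left_le_one_le)
        moreover have "norm (?B x k) \<le> lp_norm p (?B x)"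
          by (rule norm_le_lp_norm[OF p bounded_op_mem[OF bB x]])
        ultimately show ?thesis
          using F(5)[of x k] x True by simp
      qed
      then have By: "lp_norm p (?B ?y) \<le> lp_norm p (?B x) + \<epsilon> * lp_norm p x"
        unfolding True by (rule lp_norm_top_le)
      have "norm (x h) = norm (?y h)" using F(3)[OF m] by simp
      also have "\<dots> \<le> lp_norm p ?y" by (rule norm_le_lp_norm[OF p y])
      also have "\<dots> \<le> M * lp_norm p (?B ?y)"
        using lower[OF y, of n] by (simp add: Py)
      also have "\<dots> \<le> M * (lp_norm p (?B x) + \<epsilon> * lp_norm p x)"
        by (rule mult_left_mono[OF By M])
      also have "\<dots> = M * lp_norm p (?B x) + e * (M * lp_norm p x) / (M * lp_norm p x + 1)"
        by (simp add: \<epsilon>_def algebra_simps)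
      also have "\<dots> \<le> M * lp_norm p (?B x) + e"
        using pos that by (simp add: field_simps)
      finally show ?thesis .
    qed
    then have "norm (x h) \<le> M * lp_norm p (?B x)" for h
      by (rule field_le_epsilon)
    then show ?thesis
      unfolding True by (rule lp_norm_top_le)
  next
    case False
    obtain C where C: "0 \<le> C" "\<And>x. x \<in> lp_space p \<Longrightarrow> lp_norm p (?B x) \<le> C * lp_norm p x"
      using bounded_op_boundE[OF bB] by metis
    show ?thesis
    proof (rule field_le_epsilon)
      fix e :: real assume e: "0 < e"
      \<comment> \<open>The tail enters twice, with \<open>\<delta>\<close> directly and with
        \<open>M * C * \<delta>\<close> through the operator; together this is exactly
        \<open>e\<close>.\<close>
      define \<delta> where "\<delta> = e / (M * C + 1)"
      have pos: "0 < M * C + 1" using M C by (simp add: add_nonneg_pos)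
      then have "0 < \<delta>" using e by (simp add: \<delta>_def)
      then obtain m where m: "lp_norm p (\<lambda>g. x g - proj_P (G m) x g) \<le> \<delta>"
        using lp_proj_approximation[OF p False G x] by blast
      let ?P = "proj_P (G m) x" and ?Q = "\<lambda>g. x g - proj_P (G m) x g"
      have P: "?P \<in> lp_space p" and Q: "?Q \<in> lp_space p"
        using lp_proj(1)[OF p x] lp_diff(1)[OF p x] by auto
      have BP: "?B ?P = (\<lambda>g. ?B x g - ?B ?Q g)"
        using bounded_op_diff[OF bB p x Q] by (simp add: proj_P_def)
      have "lp_norm p (?B ?P) \<le> lp_norm p (?B x) + lp_norm p (?B ?Q)"
        unfolding BP by (rule lp_diff(2)[OF p bounded_op_mem[OF bB x] bounded_op_mem[OF bB Q]])
      also have "\<dots> \<le> lp_norm p (?B x) + C * \<delta>"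
        using C(2)[OF Q] mult_left_mono[OF m C(1)] by linarith
      finally have "lp_norm p ?P \<le> M * (lp_norm p (?B x) + C * \<delta>)"
        using lower[OF x, of m] mult_left_mono[OF _ M] by (meson order_trans)
      moreover have "lp_norm p x \<le> lp_norm p ?P + lp_norm p ?Q"
        using lp_add(2)[OF p P Q] by simp
      ultimately have "lp_norm p x \<le> M * lp_norm p (?B x) + (M * C + 1) * \<delta>"
        using m by (simp add: algebra_simps)
      then show "lp_norm p x \<le> M * lp_norm p (?B x) + e"
        using pos by (simp add: \<delta>_def)
    qed
  qed
qed

section \<open>Resolvent norms along limits of orbits\<close>

lemma is_op_inverse_op_inverse:
  assumes "op_invertible p T"
  shows "is_op_inverse p T (op_inverse p T)"
  using someI_ex[of "is_op_inverse p T"] assms by (simp add: op_invertible_def op_inverse_def)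

text \<open>Stated for any sequence of group elements, so that it covers both the limit sets of
  pseudoergodic points and dense orbits.\<close>

lemma op_norm_inverse_le_of_orbit_limit:
  fixes \<alpha> :: "'g::group_add \<Rightarrow> 'w::metric_space \<Rightarrow> 'w"
    and A :: "'w \<Rightarrow> ('g, 'y::complex_banach) seq \<Rightarrow> ('g, 'y) seq"
  assumes p: "1 \<le> p" and G: "admissible_exhaustion G"
    and fam: "operator_family p G \<Omega> \<alpha> A"
    and orbit: "\<And>g. \<alpha> g \<omega> \<in> \<Omega>"
    and \<omega>: "\<omega> \<in> \<Omega>" and \<nu>: "\<nu> \<in> \<Omega>" and lim: "(\<lambda>n. \<alpha> (gs n) \<omega>) \<longlonglongrightarrow> \<nu>"
    and inv: "op_invertible p (op_shift_scalar z (A \<omega>))" "op_invertible p (op_shift_scalar z (A \<nu>))"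
  shows "op_norm p (op_inverse p (op_shift_scalar z (A \<nu>)))
    \<le> op_norm p (op_inverse p (op_shift_scalar z (A \<omega>)))"
proof -
  define B where "B \<kappa> = op_shift_scalar z (A \<kappa>)" for \<kappa>
  define R where "R \<kappa> = op_inverse p (B \<kappa>)" for \<kappa>
  define M where "M = op_norm p (R \<omega>)"
  have R: "bounded_op p (R \<kappa>)" "\<And>x. x \<in> lp_space p \<Longrightarrow> R \<kappa> (B \<kappa> x) = x"
    "\<And>x. x \<in> lp_space p \<Longrightarrow> B \<kappa> (R \<kappa> x) = x" if "\<kappa> \<in> {\<omega>, \<nu>}" for \<kappa>
    using is_op_inverse_op_inverse[of p "B \<kappa>"] inv that unfolding is_op_inverse_def R_def B_def
    by blast+
  have bA: "bounded_op p (A \<kappa>)" if "\<kappa> \<in> \<Omega>" for \<kappa>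
    using fam that by (simp add: operator_family_def L_P_def)
  have bB: "bounded_op p (B \<kappa>)" if "\<kappa> \<in> \<Omega>" for \<kappa>
    unfolding B_def by (rule bounded_op_shift_scalar[OF p bA[OF that]])
  have M: "0 \<le> M"
    unfolding M_def by (rule op_norm_nonneg[OF p R(1)]) simp
  have lower_\<omega>: "lp_norm p x \<le> M * lp_norm p (B \<omega> x)" if "x \<in> lp_space p" for x
    using op_norm_bound[OF p R(1) bounded_op_mem[OF bB[OF \<omega>] that], of \<omega>] R(2)[OF _ that]
    by (simp add: M_def)
  \<comment> \<open>Shifts are isometries and commute with scalars, so equivariance conjugates
    \<open>B \<omega>\<close> to \<open>B (\<alpha> g \<omega>)\<close> and preserves the constant
    \<open>M\<close>.\<close>
  have lower_orbit: "lp_norm p x \<le> M * lp_norm p (B (\<alpha> g \<omega>) x)" if x: "x \<in> lp_space p" for x g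
  proof -
    have "A (\<alpha> g \<omega>) x = shift_V g (A \<omega> (shift_V (- g) x))"
      using fam \<omega> x by (simp add: operator_family_def)
    then have "B (\<alpha> g \<omega>) x = shift_V g (B \<omega> (shift_V (- g) x))"
      by (simp add: B_def op_shift_scalar_def shift_V_def fun_eq_iff)
    then show ?thesis
      using lower_\<omega>[of "shift_V (- g) x"] x by (simp add: lp_shift)
  qed
  \<comment> \<open>P-strong convergence controls only products with P-compact operators. Taking the
    projection to \<open>G m\<close> as such an operator makes \<open>B\<close> at the orbit points
    close to \<open>B \<nu>\<close> in norm on truncated sequences.\<close>
  have lower_proj: "lp_norm p (proj_P (G m) x) \<le> M * lp_norm p (B \<nu> (proj_P (G m) x))"
    if x: "x \<in> lp_space p" for m x
  proof (rule field_le_epsilon)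
    fix e :: real assume e: "0 < e"
    let ?P = "proj_P (G m) :: ('g, 'y) seq \<Rightarrow> _" and ?D = "\<lambda>n. op_diff (A (\<alpha> (gs n) \<omega>)) (A \<nu>)"
    have P: "?P x \<in> lp_space p" by (rule lp_proj(1)[OF p x])
    have "P_strong_lim p G (\<lambda>n. A (\<alpha> (gs n) \<omega>)) (A \<nu>)"
      using fam[unfolded operator_family_def, THEN conjunct2, THEN conjunct2, rule_format,
          of "\<lambda>n. \<alpha> (gs n) \<omega>"] orbit \<nu> lim by simp
    then have sum0: "(\<lambda>n. op_norm p (?P \<circ> ?D n) + op_norm p (?D n \<circ> ?P)) \<longlonglongrightarrow> 0"
      unfolding P_strong_lim_def using P_compact_proj[OF p G] by blast
    have bD: "bounded_op p (?D n)" for n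
      by (rule bounded_op_op_diff[OF p bA[OF orbit] bA[OF \<nu>]])
    have bPD: "bounded_op p (?P \<circ> ?D n)" and bDP: "bounded_op p (?D n \<circ> ?P)" for n
      using bounded_op_comp bD bounded_op_proj[OF p] by blast+
    \<comment> \<open>The other summand of \<open>sum0\<close> is nonnegative, so this one is
      squeezed to 0.\<close>
    have "(\<lambda>n. op_norm p (?D n \<circ> ?P)) \<longlonglongrightarrow> 0"
      by (rule tendsto_sandwich[OF _ _ tendsto_const sum0])
        (simp_all add: op_norm_nonneg[OF p bPD] op_norm_nonneg[OF p bDP])
    moreover define \<epsilon> where "\<epsilon> = e / (M * lp_norm p x + 1)"
    have pos: "0 < M * lp_norm p x + 1"
      using M lp_norm_nonneg[OF x] by (simp add: add_nonneg_pos)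
    then have \<epsilon>: "0 < \<epsilon>" using e by (simp add: \<epsilon>_def)
    ultimately have "\<forall>\<^sub>F n in sequentially. \<forall>x\<in>lp_space p. lp_norm p ((?D n \<circ> ?P) x) \<le> \<epsilon> * lp_norm p x"
      by (intro op_norm_tendsto_zeroD[OF p bDP])
    then obtain n where n: "lp_norm p (?D n (?P x)) \<le> \<epsilon> * lp_norm p x"
      using x by (auto simp: eventually_sequentially)
    let ?\<kappa> = "\<alpha> (gs n) \<omega>"
    have "B ?\<kappa> (?P x) = (\<lambda>g. B \<nu> (?P x) g - ?D n (?P x) g)"
      by (simp add: B_def op_shift_scalar_def op_diff_def)
    then have "lp_norm p (B ?\<kappa> (?P x)) \<le> lp_norm p (B \<nu> (?P x)) + lp_norm p (?D n (?P x))"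
      using lp_diff(2)[OF p bounded_op_mem[OF bB[OF \<nu>] P] bounded_op_mem[OF bD P]] by simp
    also have "\<dots> \<le> lp_norm p (B \<nu> (?P x)) + \<epsilon> * lp_norm p x"
      using n by simp
    finally have "lp_norm p (?P x) \<le> M * (lp_norm p (B \<nu> (?P x)) + \<epsilon> * lp_norm p x)"
      using lower_orbit[OF P, of "gs n"] mult_left_mono[OF _ M] by (meson order_trans)
    also have "\<dots> = M * lp_norm p (B \<nu> (?P x)) + e * (M * lp_norm p x) / (M * lp_norm p x + 1)"
      by (simp add: \<epsilon>_def algebra_simps)
    also have "\<dots> \<le> M * lp_norm p (B \<nu> (?P x)) + e"
      using pos e by (simp add: field_simps)
    finally show "lp_norm p (?P x) \<le> M * lp_norm p (B \<nu> (?P x)) + e" .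
  qed
  have "L_P p G (A \<nu>)"
    using fam \<nu> by (simp add: operator_family_def)
  then have lower_\<nu>: "lp_norm p x \<le> M * lp_norm p (B \<nu> x)" if "x \<in> lp_space p" for x
    unfolding B_def by (rule lower_bound_extends[OF p G _ M lower_proj[unfolded B_def] that])
  \<comment> \<open>The lower bound at \<open>x = R \<nu> y\<close> becomes a bound on the inverse,
    since \<open>B \<nu> (R \<nu> y) = y\<close>.\<close>
  have "lp_norm p (R \<nu> y) \<le> M * lp_norm p y" if "y \<in> lp_space p" for y
    using lower_\<nu>[OF bounded_op_mem[OF R(1) that], of \<nu>] R(3)[OF _ that] by simp
  then show ?thesis
    using op_norm_le[OF p M, of "R \<nu>"] by (simp add: M_def R_def B_def)
qed

theorem theorem4p7:
  fixes p :: ennreal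
    and G :: "nat \<Rightarrow> ('g::{countable, group_add}) set"
    and \<Omega> :: "'w::metric_space set"
    and \<alpha> :: "'g \<Rightarrow> 'w \<Rightarrow> 'w"
    and A :: "'w \<Rightarrow> ('g, 'y::complex_banach) seq \<Rightarrow> ('g, 'y) seq"
    and z :: complex
  assumes p: "1 \<le> p"
    and G: "admissible_exhaustion G"
    and dyn: "dynamical_system \<Omega> \<alpha>"
    and fam: "operator_family p G \<Omega> \<alpha> A"
    and lam: "z \<notin> (\<Union>\<omega>\<in>\<Omega>. spectrum_op p (A \<omega>))"
  shows "(\<forall>\<omega>\<in>\<Omega>. \<forall>\<nu>\<in>\<Omega>. pseudoergodic \<Omega> \<alpha> \<omega> \<longrightarrow> pseudoergodic \<Omega> \<alpha> \<nu> \<longrightarrow>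
            op_norm p (op_inverse p (op_shift_scalar z (A \<omega>)))
          = op_norm p (op_inverse p (op_shift_scalar z (A \<nu>))))
       \<and> (minimal_system \<Omega> \<alpha> \<longrightarrow>
          (\<forall>\<omega>\<in>\<Omega>. \<forall>\<nu>\<in>\<Omega>.
            op_norm p (op_inverse p (op_shift_scalar z (A \<omega>)))
          = op_norm p (op_inverse p (op_shift_scalar z (A \<nu>)))))"
proof -
  have orbit: "\<alpha> g \<omega> \<in> \<Omega>" if "\<omega> \<in> \<Omega>" for g \<omega>
    using dyn that unfolding dynamical_system_def homeomorphism_def by blast
  have inv: "op_invertible p (op_shift_scalar z (A \<omega>))" if "\<omega> \<in> \<Omega>" for \<omega>
    using lam that by (auto simp: spectrum_op_def)
  have le: "op_norm p (op_inverse p (op_shift_scalar z (A \<nu>)))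
      \<le> op_norm p (op_inverse p (op_shift_scalar z (A \<omega>)))"
    if "\<omega> \<in> \<Omega>" "\<nu> \<in> \<Omega>" "\<exists>gs. (\<lambda>n. \<alpha> (gs n) \<omega>) \<longlonglongrightarrow> \<nu>" for \<omega> \<nu>
    using op_norm_inverse_le_of_orbit_limit[OF p G fam orbit] inv that by blast
  \<comment> \<open>Here \<open>\<nu>\<close> is any point of \<open>\<Omega>\<close>, so if both
    points are pseudoergodic, \<open>le\<close> applies in both directions.\<close>
  have "\<exists>gs. (\<lambda>n. \<alpha> (gs n) \<omega>) \<longlonglongrightarrow> \<nu>" if "pseudoergodic \<Omega> \<alpha> \<omega>" "\<nu> \<in> \<Omega>" for \<omega> \<nu>
    using that by (auto simp: pseudoergodic_def limit_set_def)
  moreover have "\<exists>gs. (\<lambda>n. \<alpha> (gs n) \<omega>) \<longlonglongrightarrow> \<nu>"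
    if "minimal_system \<Omega> \<alpha>" "\<omega> \<in> \<Omega>" "\<nu> \<in> \<Omega>" for \<omega> \<nu>
  proof -
    have "\<nu> \<in> closure (range (\<lambda>g. \<alpha> g \<omega>))"
      using that by (auto simp: minimal_system_def)
    then obtain u where u: "\<And>n. u n \<in> range (\<lambda>g. \<alpha> g \<omega>)" "u \<longlonglongrightarrow> \<nu>"
      unfolding closure_sequential by blast
    then have "\<forall>n. \<exists>g. u n = \<alpha> g \<omega>"
      by blast
    then obtain gs where "\<And>n. u n = \<alpha> (gs n) \<omega>"
      by metis
    then have "u = (\<lambda>n. \<alpha> (gs n) \<omega>)" by auto
    then show ?thesis using u(2) by auto
  qed
  ultimately show ?thesis
    by (intro conjI impI ballI antisym le) blast+
qed

end
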